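(* Let $I,T,S,H$ be nonempty finite sets. For all $i\in I$ and $h\in H$ let $w_{i0}>0$ and $w_{ih}>0$ be real numbers, and for all $i\in I$, $h\in H$, $t\in T$, $s\in S$ let $d^{ts}_{ih}\ge 0$ be real numbers. Put $\overline{d}^{ts}_i := \max_{h\in H}\{d^{ts}_{ih}\}$. Then for all $i\in I$, $t\in T$, $s\in S$, every binary vector $x^{ts}=(x^{ts}_h)_{h\in H}\in\{0,1\}^{|H|}$ and every $q^{ts}_i\in\mathbb{R}$, the inequality $$q^{ts}_i \le \sum_{h\in H} \frac{d^{ts}_{ih}w_{ih}x^{ts}_h}{w_{i0}+\sum_{h'\in H} w_{ih'}x^{ts}_{h'}}$$ holds if and only if the second-order conic inequality $$\left\| \begin{bmatrix} 2\sqrt{\overline{d}^{ts}_i w_{i0}}\\ \left\{2\sqrt{(\overline{d}^{ts}_i - d^{ts}_{ih}) w_{ih}}\; x^{ts}_h\right\}_{h\in H}\\ w_{i0} + \sum_{h\in H} w_{ih} x^{ts}_h - \overline{d}^{ts}_i + q^{ts}_i \end{bmatrix} \right\|_2 \le w_{i0} + \sum_{h\in H} w_{ih} x^{ts}_h + \overline{d}^{ts}_i - q^{ts}_i$$ holds.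
   Context: In the underlying model, $I$ is the set of demand nodes, $T$ the set of time periods, $S$ the set of scenarios, and $H=J\times K$ the set of pairs (candidate location $j$, station type $k$). The weights are $w_{ih}=\exp(\alpha_{ijk}+\beta s_{ij})$ for $h=(j,k)$ and $w_{i0}=\exp(\alpha_{i0})$, hence positive. The coefficients are $d^{ts}_{ih}=r_k d^{ts}_i$ for $h=(j,k)$, where $r_k$ is the unit revenue of a type-$k$ station and $d^{ts}_i$ is the charging demand at node $i$ in period $t$ and scenario $s$. The location variables $x^{ts}_h$ are binary, and $q^{ts}_i$ is a real variable representing revenue. The vector in the norm has $|H|+2$ entries (one first entry, one entry for each $h\in H$, one last entry), and $\|\cdot\|_2$ is the Euclidean norm. *)

theory Defs
  imports "HOL-Analysis.Finite_Cartesian_Product"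
begin

text \<open>
  The nonempty finite sets I, T, S, H are finite types. The weight with index 0 is kept apart as
  \<open>w0 i\<close>, and the coefficient with superscripts t, s and subscripts i, h is \<open>d t s i h\<close>.
\<close>

definition dbar :: "('t \<Rightarrow> 's \<Rightarrow> 'i \<Rightarrow> 'h::finite \<Rightarrow> real) \<Rightarrow> 't \<Rightarrow> 's \<Rightarrow> 'i \<Rightarrow> real" where
  "dbar d t s i = (MAX h. d t s i h)"

text \<open>
  The index type \<open>unit + 'h + unit\<close> gives the vector one first entry, one entry for each element
  of H and one last entry, so that \<open>norm\<close> is its Euclidean norm.
\<close>

definition conic_vec ::
  "('i \<Rightarrow> real) \<Rightarrow> ('i \<Rightarrow> 'h \<Rightarrow> real) \<Rightarrow> ('t \<Rightarrow> 's \<Rightarrow> 'i \<Rightarrow> 'h \<Rightarrow> real) \<Rightarrow>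
   't \<Rightarrow> 's \<Rightarrow> 'i \<Rightarrow> real ^ 'h::finite \<Rightarrow> real \<Rightarrow> real ^ (unit + 'h + unit)" where
  "conic_vec w0 w d t s i x q =
     (\<chi> e. case e of
        Inl _ \<Rightarrow> 2 * sqrt (dbar d t s i * w0 i)
      | Inr (Inl h) \<Rightarrow> 2 * sqrt ((dbar d t s i - d t s i h) * w i h) * x $ h
      | Inr (Inr _) \<Rightarrow> w0 i + (\<Sum>h\<in>UNIV. w i h * x $ h) - dbar d t s i + q)"

end

theory Submission
  imports Defs
begin

text \<open>
  Write \<open>W\<close> for the denominator, \<open>D\<close> for the maximal coefficient and \<open>u = D - q\<close>. Since \<open>x\<^sup>2 = x\<close> for
  binary \<open>x\<close>, the squared norm is \<open>4 C + (W - u)\<^sup>2\<close> with \<open>C = D W - (\<Sum>h. d h w h x h) \<ge> 0\<close>, so the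
  conic inequality is the hyperbolic constraint \<open>C \<le> W u\<close>, that is, \<open>W q \<le> (\<Sum>h. d h w h x h)\<close>.
\<close>

text \<open>Since (W + u)^2 - (W - u)^2 = 4 W u, squaring turns the left side into the right one.
  Undoing the squaring needs W + u to be nonnegative.\<close>

lemma sqrt_le_add_iff_le_mult:
  fixes W u C :: real
  assumes "0 < W" and "0 \<le> C"
  shows "sqrt (4 * C + (W - u)\<^sup>2) \<le> W + u \<longleftrightarrow> C \<le> W * u"
proof -
  have square: "4 * C + (W - u)\<^sup>2 \<le> (W + u)\<^sup>2 \<longleftrightarrow> C \<le> W * u"
    by (simp add: power2_eq_square algebra_simps)
  show ?thesis
  proof
    assume "sqrt (4 * C + (W - u)\<^sup>2) \<le> W + u"
    then show "C \<le> W * u"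
      using square sqrt_le_D by blast
  next
    assume le: "C \<le> W * u"
    \<comment> \<open>A negative u would make \<open>W * u\<close> negative, against 0 \<le> C \<le>
      \<open>W * u\<close>.\<close>
    then have "0 \<le> u"
      using assms by (meson order_trans zero_le_mult_iff not_less)
    then show "sqrt (4 * C + (W - u)\<^sup>2) \<le> W + u"
      using square le assms by (intro real_le_lsqrt) auto
  qed
qed

lemma dbar_ge: "d t s i h \<le> dbar d t s i"
  unfolding dbar_def by (intro Max_ge) auto

text \<open>The squared first entry supplies the \<open>w0 i\<close> term of the product with
  \<open>dbar\<close>. The squared middle entries supply the remaining terms and the subtracted
  revenue sum.\<close>

lemma norm_conic_vec:
  fixes w0 :: "'i \<Rightarrow> real"
    and w :: "'i \<Rightarrow> 'h::finite \<Rightarrow> real"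
  assumes "0 \<le> w0 i" and "\<And>h. 0 \<le> w i h" and "0 \<le> dbar d t s i"
    and "\<And>h. x $ h \<in> {0, 1}"
  shows "norm (conic_vec w0 w d t s i x q) =
    sqrt (4 * (dbar d t s i * (w0 i + (\<Sum>h\<in>UNIV. w i h * x $ h))
               - (\<Sum>h\<in>UNIV. d t s i h * w i h * x $ h))
          + (w0 i + (\<Sum>h\<in>UNIV. w i h * x $ h) - (dbar d t s i - q))\<^sup>2)"
proof -
  define D where "D = dbar d t s i"
  define A where "A = w0 i + (\<Sum>h\<in>UNIV. w i h * x $ h) - D + q"
  have entry: "(2 * sqrt ((D - d t s i h) * w i h) * x $ h)\<^sup>2
      = 4 * (D * (w i h * x $ h) - d t s i h * w i h * x $ h)" for h
  proof -
    \<comment> \<open>This sign allows the square to cancel the root; idempotence of a binary entry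
      then makes the result linear in x.\<close>
    have "0 \<le> (D - d t s i h) * w i h"
      using assms(2) dbar_ge[of d t s i h] by (simp add: D_def)
    moreover have "(x $ h)\<^sup>2 = x $ h"
      using assms(4)[of h] by auto
    ultimately show ?thesis
      by (simp add: algebra_simps)
  qed
  \<comment> \<open>Reading \<open>UNIV\<close> of the index type as a disjoint sum splits the sum
    of squares into three blocks, the outer two being single terms.\<close>
  have "norm (conic_vec w0 w d t s i x q) =
      sqrt ((2 * sqrt (D * w0 i))\<^sup>2
        + ((\<Sum>h\<in>UNIV. (2 * sqrt ((D - d t s i h) * w i h) * x $ h)\<^sup>2) + A\<^sup>2))"
    by (simp add: norm_vec_def L2_set_def conic_vec_def D_def A_def sum.Plus UNIV_unit
        flip: UNIV_Plus_UNIV)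
  also have "(2 * sqrt (D * w0 i))\<^sup>2 = 4 * (D * w0 i)"
    using assms(1,3) by (simp add: D_def power_mult_distrib)
  also have "(\<Sum>h\<in>UNIV. (2 * sqrt ((D - d t s i h) * w i h) * x $ h)\<^sup>2)
      = 4 * (D * (\<Sum>h\<in>UNIV. w i h * x $ h) - (\<Sum>h\<in>UNIV. d t s i h * w i h * x $ h))"
    by (simp only: entry sum_subtractf flip: sum_distrib_left)
  finally show ?thesis
    by (simp add: A_def D_def algebra_simps)
qed

theorem theorem1:
  fixes w0 :: "'i::finite \<Rightarrow> real"
    and w :: "'i \<Rightarrow> 'h::finite \<Rightarrow> real"
    and d :: "'t::finite \<Rightarrow> 's::finite \<Rightarrow> 'i \<Rightarrow> 'h \<Rightarrow> real"
  assumes "\<forall>i. w0 i > 0"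
    and "\<forall>i h. w i h > 0"
    and "\<forall>i h t s. d t s i h \<ge> 0"
  shows "\<forall>i t s. \<forall>x :: real ^ 'h. (\<forall>h. x $ h \<in> {0, 1}) \<longrightarrow> (\<forall>q :: real.
    q \<le> (\<Sum>h\<in>UNIV. d t s i h * w i h * x $ h / (w0 i + (\<Sum>h'\<in>UNIV. w i h' * x $ h')))
    \<longleftrightarrow>
    norm (conic_vec w0 w d t s i x q)
      \<le> w0 i + (\<Sum>h\<in>UNIV. w i h * x $ h) + dbar d t s i - q)"
proof (intro allI impI)
  fix i t s and x :: "real ^ 'h" and q :: real
  assume x: "\<forall>h. x $ h \<in> {0, 1}"
  define D where "D = dbar d t s i"
  define W where "W = w0 i + (\<Sum>h\<in>UNIV. w i h * x $ h)"
  define N where "N = (\<Sum>h\<in>UNIV. d t s i h * w i h * x $ h)"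
  have w_nonneg: "0 \<le> w i h" for h
    using assms(2) by (simp add: less_imp_le)
  have x_nonneg: "0 \<le> x $ h" for h
    using x[rule_format, of h] by auto
  have wx_nonneg: "0 \<le> w i h * x $ h" for h
    by (simp add: w_nonneg x_nonneg)
  \<comment> \<open>Any single coefficient is a nonnegative lower bound for the maximum; one exists
    because the type of h is inhabited.\<close>
  have D_nonneg: "0 \<le> D"
    unfolding D_def by (rule order_trans[OF _ dbar_ge]) (simp add: assms(3))
  have W_pos: "0 < W"
    using assms(1) by (simp add: W_def add_pos_nonneg sum_nonneg wx_nonneg)
  \<comment> \<open>Bounding each coefficient by D, then adding the nonnegative term
    \<open>D * w0 i\<close>, gives the sign needed for the hyperbolic constraint.\<close>
  have "N \<le> D * (\<Sum>h\<in>UNIV. w i h * x $ h)"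
    unfolding N_def D_def sum_distrib_left mult.assoc
    by (intro sum_mono mult_right_mono dbar_ge wx_nonneg)
  also have "\<dots> \<le> D * W"
    using assms(1) D_nonneg by (intro mult_left_mono) (simp_all add: W_def less_imp_le)
  finally have C_nonneg: "0 \<le> D * W - N" by simp
  have norm_eq: "norm (conic_vec w0 w d t s i x q) = sqrt (4 * (D * W - N) + (W - (D - q))\<^sup>2)"
    unfolding D_def W_def N_def
    using assms(1) x w_nonneg D_nonneg by (intro norm_conic_vec) (auto simp: D_def less_imp_le)
  have "q \<le> (\<Sum>h\<in>UNIV. d t s i h * w i h * x $ h / W) \<longleftrightarrow> q \<le> N / W"
    by (simp add: N_def sum_divide_distrib)
  \<comment> \<open>Clear the positive denominator, then subtract both sides of q W \<le> N from D
    W.\<close>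
  also have "\<dots> \<longleftrightarrow> D * W - N \<le> W * (D - q)"
    using W_pos by (simp add: pos_le_divide_eq algebra_simps)
  also have "\<dots> \<longleftrightarrow> norm (conic_vec w0 w d t s i x q) \<le> W + (D - q)"
    unfolding norm_eq by (rule sqrt_le_add_iff_le_mult[OF W_pos C_nonneg, symmetric])
  finally show "q \<le> (\<Sum>h\<in>UNIV. d t s i h * w i h * x $ h / (w0 i + (\<Sum>h'\<in>UNIV. w i h' * x $ h')))
    \<longleftrightarrow> norm (conic_vec w0 w d t s i x q)
      \<le> w0 i + (\<Sum>h\<in>UNIV. w i h * x $ h) + dbar d t s i - q"
    by (simp add: W_def D_def add_diff_eq)
qed

end
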